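(* Let $CC$ be a C0-system. Then the following are equivalent: (1) for every $X\in Ob(CC)$ with $l(X)>0$ and every morphism $f:Y\to ft(X)$, the canonical square with top arrow $q(f,X):f^*X\to X$, left arrow $p_{f^*X}:f^*X\to Y$, right arrow $p_X:X\to ft(X)$ and bottom arrow $f:Y\to ft(X)$ is a pull-back square; (2) there is given a structure of a C-system on $CC$, i.e. there exists an operation $f\mapsto s_f$ on $CC$ making the C0-system $CC$ into a C-system.
   Context: A pre-category $C$ is a pair of sets $Mor(C)$, $Ob(C)$ with source and target maps $\partial_0,\partial_1:Mor(C)\to Ob(C)$, an identity map $Id:Ob(C)\to Mor(C)$ and a composition satisfying the usual unit and associativity laws (i.e. a small category, considered up to isomorphism and not equivalence). Composition is written in diagrammatic order: for $f:X\to Y$, $g:Y\to Z$ the composite is $f\circ g=fg:X\to Z$. A C0-system is a pre-category $CC$ with: a function $l:Ob(CC)\to\mathbb{N}$; an object $pt$; a map $ft:Ob(CC)\to Ob(CC)$; for each $X\in Ob(CC)$ a morphism $p_X:X\to ft(X)$; for each $X$ with $l(X)>0$ and each morphism $f:Y\to ft(X)$ an object $f^*X$ (also written $f^*(X)$) and a morphism $q(f,X):f^*X\to X$; such that (i) $l^{-1}(0)=\{pt\}$; (ii) if $l(X)>0$ then $l(ft(X))=l(X)-1$; (iii) $ft(pt)=pt$; (iv) $pt$ is a final object; (v) if $l(X)>0$ and $f:Y\to ft(X)$ then $l(f^*X)>0$, $ft(f^*X)=Y$ and $q(f,X)\circ p_X=p_{f^*X}\circ f$ as morphisms $f^*X\to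 ft(X)$; (vi) if $l(X)>0$ then $Id_{ft(X)}^*(X)=X$ and $q(Id_{ft(X)},X)=Id_X$; (vii) if $l(X)>0$, $g:Z\to Y$ and $f:Y\to ft(X)$ then $(gf)^*(X)=g^*(f^*(X))$ and $q(gf,X)=q(g,f^*X)\,q(f,X)$. For $f:Y\to X$ put $ft(f)=f\circ p_X:Y\to ft(X)$. A C-system is a C0-system together with an operation $f\mapsto s_f$ defined for all morphisms $f:Y\to X$ with $l(X)>0$ such that (a) $s_f:Y\to (ft(f))^*(X)$; (b) $s_f\circ p_{(ft(f))^*(X)}=Id_Y$; (c) $f=s_f\circ q(ft(f),X)$; (d) if $X=g^*(U)$ where $l(U)>0$ and $g:ft(X)\to ft(U)$, then $s_f=s_{f\circ q(g,U)}$. *)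

theory Defs
  imports Main
begin

record ('o, 'm) precat =
  Ob :: "'o set"
  Mor :: "'m set"
  src :: "'m \<Rightarrow> 'o"
  tgt :: "'m \<Rightarrow> 'o"
  Idm :: "'o \<Rightarrow> 'm"
  comp_m :: "'m \<Rightarrow> 'm \<Rightarrow> 'm"  (infixl \<open>\<cdot>\<index>\<close> 70)

definition Hom :: "('o, 'm, 'z) precat_scheme \<Rightarrow> 'o \<Rightarrow> 'o \<Rightarrow> 'm set" where
  "Hom C X Y = {f \<in> Mor C. src C f = X \<and> tgt C f = Y}"

text \<open>
  Composition is in diagrammatic order. It and all later operations are total HOL functions
  whose values outside the stated domains are irrelevant.
\<close>

locale precategory =
  fixes C :: "('o, 'm, 'z) precat_scheme" (structure)
  assumes src_Ob: "f \<in> Mor C \<Longrightarrow> src C f \<in> Ob C"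
    and tgt_Ob: "f \<in> Mor C \<Longrightarrow> tgt C f \<in> Ob C"
    and Id_Hom: "X \<in> Ob C \<Longrightarrow> Idm C X \<in> Hom C X X"
    and comp_Hom: "\<lbrakk>f \<in> Hom C X Y; g \<in> Hom C Y Z\<rbrakk> \<Longrightarrow> f \<cdot> g \<in> Hom C X Z"
    and Id_left: "f \<in> Hom C X Y \<Longrightarrow> Idm C X \<cdot> f = f"
    and Id_right: "f \<in> Hom C X Y \<Longrightarrow> f \<cdot> Idm C Y = f"
    and comp_assoc:
      "\<lbrakk>f \<in> Hom C W X; g \<in> Hom C X Y; h \<in> Hom C Y Z\<rbrakk> \<Longrightarrow> (f \<cdot> g) \<cdot> h = f \<cdot> (g \<cdot> h)"

definition final_object :: "('o, 'm, 'z) precat_scheme \<Rightarrow> 'o \<Rightarrow> bool" where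
  "final_object C T \<longleftrightarrow> T \<in> Ob C \<and> (\<forall>X\<in>Ob C. \<exists>!f. f \<in> Hom C X T)"

text \<open>
  The arguments of a square are its top, left, right and bottom arrow, as in
  \<open>t : A \<rightarrow> B\<close>, \<open>l : A \<rightarrow> B'\<close>, \<open>r : B \<rightarrow> D\<close>, \<open>b : B' \<rightarrow> D\<close>.
\<close>

definition commutative_square ::
    "('o, 'm, 'z) precat_scheme \<Rightarrow> 'm \<Rightarrow> 'm \<Rightarrow> 'm \<Rightarrow> 'm \<Rightarrow> bool" where
  "commutative_square C t l r b \<longleftrightarrow>
     {t, l, r, b} \<subseteq> Mor C \<and>
     src C t = src C l \<and> tgt C t = src C r \<and> tgt C l = src C b \<and> tgt C r = tgt C b \<and>
     t \<cdot>\<^bsub>C\<^esub> r = l \<cdot>\<^bsub>C\<^esub> b"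

definition pullback_square ::
    "('o, 'm, 'z) precat_scheme \<Rightarrow> 'm \<Rightarrow> 'm \<Rightarrow> 'm \<Rightarrow> 'm \<Rightarrow> bool" where
  "pullback_square C t l r b \<longleftrightarrow>
     commutative_square C t l r b \<and>
     (\<forall>u v. commutative_square C u v r b \<longrightarrow>
        (\<exists>!w. w \<in> Hom C (src C u) (src C t) \<and> w \<cdot>\<^bsub>C\<^esub> t = u \<and> w \<cdot>\<^bsub>C\<^esub> l = v))"

text \<open>
  \<open>pr CC X\<close> is \<open>p\<^sub>X\<close>, \<open>pb CC f X\<close> is \<open>f\<^sup>*X\<close> and \<open>qm CC f X\<close> is \<open>q(f, X)\<close>; the last two are
  meaningful for \<open>l(X) > 0\<close> and \<open>f : Y \<rightarrow> ft(X)\<close>.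
\<close>

record ('o, 'm) c0_data = "('o, 'm) precat" +
  len :: "'o \<Rightarrow> nat"
  pt :: 'o
  ft :: "'o \<Rightarrow> 'o"
  pr :: "'o \<Rightarrow> 'm"
  pb :: "'m \<Rightarrow> 'o \<Rightarrow> 'o"
  qm :: "'m \<Rightarrow> 'o \<Rightarrow> 'm"

locale C0_system = precategory CC
  for CC :: "('o, 'm, 'z) c0_data_scheme" (structure) +
  assumes pt_Ob: "pt CC \<in> Ob CC"
    and ft_Ob: "X \<in> Ob CC \<Longrightarrow> ft CC X \<in> Ob CC"
    and pr_Hom: "X \<in> Ob CC \<Longrightarrow> pr CC X \<in> Hom CC X (ft CC X)"
    and pb_Ob: "\<lbrakk>X \<in> Ob CC; len CC X > 0; f \<in> Hom CC Y (ft CC X)\<rbrakk> \<Longrightarrow> pb CC f X \<in> Ob CC"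
    and qm_Hom: "\<lbrakk>X \<in> Ob CC; len CC X > 0; f \<in> Hom CC Y (ft CC X)\<rbrakk>
      \<Longrightarrow> qm CC f X \<in> Hom CC (pb CC f X) X"
    and len_zero: "{X \<in> Ob CC. len CC X = 0} = {pt CC}"
    and len_ft: "\<lbrakk>X \<in> Ob CC; len CC X > 0\<rbrakk> \<Longrightarrow> len CC (ft CC X) = len CC X - 1"
    and ft_pt: "ft CC (pt CC) = pt CC"
    and pt_final: "final_object CC (pt CC)"
    and len_pb: "\<lbrakk>X \<in> Ob CC; len CC X > 0; f \<in> Hom CC Y (ft CC X)\<rbrakk> \<Longrightarrow> len CC (pb CC f X) > 0"
    and ft_pb: "\<lbrakk>X \<in> Ob CC; len CC X > 0; f \<in> Hom CC Y (ft CC X)\<rbrakk> \<Longrightarrow> ft CC (pb CC f X) = Y"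
    and qm_pr: "\<lbrakk>X \<in> Ob CC; len CC X > 0; f \<in> Hom CC Y (ft CC X)\<rbrakk>
      \<Longrightarrow> qm CC f X \<cdot> pr CC X = pr CC (pb CC f X) \<cdot> f"
    and pb_Id: "\<lbrakk>X \<in> Ob CC; len CC X > 0\<rbrakk> \<Longrightarrow> pb CC (Idm CC (ft CC X)) X = X"
    and qm_Id: "\<lbrakk>X \<in> Ob CC; len CC X > 0\<rbrakk> \<Longrightarrow> qm CC (Idm CC (ft CC X)) X = Idm CC X"
    and pb_comp: "\<lbrakk>X \<in> Ob CC; len CC X > 0; g \<in> Hom CC Z Y; f \<in> Hom CC Y (ft CC X)\<rbrakk>
      \<Longrightarrow> pb CC (g \<cdot> f) X = pb CC g (pb CC f X)"
    and qm_comp: "\<lbrakk>X \<in> Ob CC; len CC X > 0; g \<in> Hom CC Z Y; f \<in> Hom CC Y (ft CC X)\<rbrakk>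
      \<Longrightarrow> qm CC (g \<cdot> f) X = qm CC g (pb CC f X) \<cdot> qm CC f X"

definition ft_mor :: "('o, 'm, 'z) c0_data_scheme \<Rightarrow> 'm \<Rightarrow> 'm" where
  "ft_mor CC f = f \<cdot>\<^bsub>CC\<^esub> pr CC (tgt CC f)"

locale C_system = C0_system CC
  for CC :: "('o, 'm, 'z) c0_data_scheme" (structure) +
  fixes s :: "'m \<Rightarrow> 'm"
  assumes s_Hom: "\<lbrakk>X \<in> Ob CC; len CC X > 0; f \<in> Hom CC Y X\<rbrakk>
      \<Longrightarrow> s f \<in> Hom CC Y (pb CC (ft_mor CC f) X)"
    and s_pr: "\<lbrakk>X \<in> Ob CC; len CC X > 0; f \<in> Hom CC Y X\<rbrakk>
      \<Longrightarrow> s f \<cdot> pr CC (pb CC (ft_mor CC f) X) = Idm CC Y"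
    and s_qm: "\<lbrakk>X \<in> Ob CC; len CC X > 0; f \<in> Hom CC Y X\<rbrakk>
      \<Longrightarrow> f = s f \<cdot> qm CC (ft_mor CC f) X"
    and s_pb: "\<lbrakk>X \<in> Ob CC; len CC X > 0; f \<in> Hom CC Y X;
        U \<in> Ob CC; len CC U > 0; g \<in> Hom CC (ft CC X) (ft CC U); X = pb CC g U\<rbrakk>
      \<Longrightarrow> s f = s (f \<cdot> qm CC g U)"

end

(* Pulling back along ft(f), a lift of the pair (f, Id) through the canonical square over X is
   exactly a section s_f with s_f q(ft(f), X) = f. So if the squares are pull-backs, s_f is this
   lift; axiom (d) holds because q(ft(f) g, U) = q(ft(f), g^*U) q(g, U), so that s_f also solves
   the lifting problem that characterises the section of f q(g, U). Conversely, for u : Z -> X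
   and v : Z -> Y with u p_X = v f, the morphism s_u q(v, f^*X) is a lift, because
   (v f)^*X = v^*(f^*X). A lift w satisfies s_w = s_{w q(f, X)} = s_u by (d), and therefore
   equals s_w q(ft(w), f^*X) = s_u q(v, f^*X) by (c). *)
theory Submission
  imports Defs
begin

lemma pullback_square_lift:
  assumes "pullback_square C t l r b" "commutative_square C u v r b" "u \<in> Hom C Z Y"
  obtains w where "w \<in> Hom C Z (src C t)" "w \<cdot>\<^bsub>C\<^esub> t = u" "w \<cdot>\<^bsub>C\<^esub> l = v"
proof -
  have "src C u = Z"
    using assms(3) by (simp add: Hom_def)
  then show thesis
    using assms that unfolding pullback_square_def by metis
qed

lemma pullback_square_lift_unique:
  assumes "pullback_square C t l r b"
    and "w \<in> Hom C Z (src C t)" "w' \<in> Hom C Z (src C t)"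
    and "w \<cdot>\<^bsub>C\<^esub> t = u" "w' \<cdot>\<^bsub>C\<^esub> t = u" "w \<cdot>\<^bsub>C\<^esub> l = v" "w' \<cdot>\<^bsub>C\<^esub> l = v"
    and "u \<in> Hom C Z Y" "commutative_square C u v r b"
  shows "w = w'"
proof -
  have "src C u = Z"
    using assms(8) by (simp add: Hom_def)
  then show ?thesis
    using assms unfolding pullback_square_def by metis
qed

context precategory
begin

lemma Hom_src: "f \<in> Hom C X Y \<Longrightarrow> X \<in> Ob C"
  and Hom_tgt: "f \<in> Hom C X Y \<Longrightarrow> Y \<in> Ob C"
  using src_Ob tgt_Ob by (auto simp: Hom_def)

lemma commutative_squareI:
  assumes "t \<in> Hom C A B" "l \<in> Hom C A B'" "r \<in> Hom C B D" "b \<in> Hom C B' D"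
    and "t \<cdot> r = l \<cdot> b"
  shows "commutative_square C t l r b"
  using assms by (auto simp: Hom_def commutative_square_def)

end

context C0_system
begin

lemma ft_mor_eq: "f \<in> Hom CC Y X \<Longrightarrow> ft_mor CC f = f \<cdot> pr CC X"
  by (simp add: ft_mor_def Hom_def)

lemma ft_mor_Hom: "f \<in> Hom CC Y X \<Longrightarrow> ft_mor CC f \<in> Hom CC Y (ft CC X)"
  using comp_Hom pr_Hom Hom_tgt by (simp add: ft_mor_eq)

lemma pr_pb_Hom:
  assumes "X \<in> Ob CC" "len CC X > 0" "f \<in> Hom CC Y (ft CC X)"
  shows "pr CC (pb CC f X) \<in> Hom CC (pb CC f X) Y"
  using pr_Hom[OF pb_Ob[OF assms]] by (simp add: ft_pb[OF assms])

lemma canonical_square_commutes: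
  assumes "X \<in> Ob CC" "len CC X > 0" "f \<in> Hom CC Y (ft CC X)"
  shows "commutative_square CC (qm CC f X) (pr CC (pb CC f X)) (pr CC X) f"
  using commutative_squareI[OF qm_Hom[OF assms] pr_pb_Hom[OF assms] pr_Hom[OF assms(1)] assms(3)]
    qm_pr[OF assms] by simp

text \<open>The canonical square over \<open>U\<close> replaces \<open>qm CC g U\<close> followed by
  \<open>pr CC U\<close> by \<open>pr CC (pb CC g U)\<close> followed by \<open>g\<close>. This
  locates the section of \<open>f \<cdot> qm CC g U\<close> that axiom (d) compares with that of
  \<open>f\<close>.\<close>

lemma ft_mor_comp_qm:
  assumes "U \<in> Ob CC" "len CC U > 0" "g \<in> Hom CC X (ft CC U)" "f \<in> Hom CC Y (pb CC g U)"
  shows "ft_mor CC (f \<cdot> qm CC g U) = ft_mor CC f \<cdot> g"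
proof -
  note q = qm_Hom[OF assms(1-3)] and p = pr_pb_Hom[OF assms(1-3)]
  have "ft_mor CC (f \<cdot> qm CC g U) = (f \<cdot> qm CC g U) \<cdot> pr CC U"
    by (rule ft_mor_eq[OF comp_Hom[OF assms(4) q]])
  also have "\<dots> = f \<cdot> (pr CC (pb CC g U) \<cdot> g)"
    using comp_assoc[OF assms(4) q pr_Hom[OF assms(1)]] qm_pr[OF assms(1-3)] by simp
  also have "\<dots> = ft_mor CC f \<cdot> g"
    using comp_assoc[OF assms(4) p assms(3)] by (simp add: ft_mor_eq[OF assms(4)])
  finally show ?thesis .
qed

text \<open>This is the cone whose lift through the canonical square with bottom arrow
  \<open>ft_mor CC f\<close> is the section of \<open>f\<close>.\<close>

lemma section_square_commutes:
  assumes "f \<in> Hom CC Y X"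
  shows "commutative_square CC f (Idm CC Y) (pr CC X) (ft_mor CC f)"
  using commutative_squareI[OF assms Id_Hom[OF Hom_src[OF assms]] pr_Hom[OF Hom_tgt[OF assms]]
      ft_mor_Hom[OF assms]] Id_left[OF ft_mor_Hom[OF assms]]
  by (simp add: ft_mor_eq[OF assms])

lemma C_system_if_pullback:
  assumes pull: "\<And>X Y f. \<lbrakk>X \<in> Ob CC; len CC X > 0; f \<in> Hom CC Y (ft CC X)\<rbrakk>
    \<Longrightarrow> pullback_square CC (qm CC f X) (pr CC (pb CC f X)) (pr CC X) f"
  shows "\<exists>s. C_system CC s"
proof -
  \<comment> \<open>The predicate collects axioms (a), (b) and (c). Source and target are read off
    \<open>f\<close>, so that \<open>s\<close> can be chosen as a function of \<open>f\<close>
    alone; where no section exists its value is arbitrary.\<close>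
  define sect where "sect w f \<longleftrightarrow>
      w \<in> Hom CC (src CC f) (pb CC (ft_mor CC f) (tgt CC f)) \<and>
      w \<cdot> pr CC (pb CC (ft_mor CC f) (tgt CC f)) = Idm CC (src CC f) \<and>
      w \<cdot> qm CC (ft_mor CC f) (tgt CC f) = f" for w f
  define s where "s f = (SOME w. sect w f)" for f
  have sect_iff: "sect w f \<longleftrightarrow> w \<in> Hom CC Y (pb CC (ft_mor CC f) X) \<and>
      w \<cdot> pr CC (pb CC (ft_mor CC f) X) = Idm CC Y \<and> w \<cdot> qm CC (ft_mor CC f) X = f"
    if "f \<in> Hom CC Y X" for w f X Y
    using that by (simp add: sect_def Hom_def)
  have src_q: "src CC (qm CC (ft_mor CC f) X) = pb CC (ft_mor CC f) X"
    if "X \<in> Ob CC" "len CC X > 0" "f \<in> Hom CC Y X" for f X Y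
    using qm_Hom[OF that(1,2) ft_mor_Hom[OF that(3)]] by (simp add: Hom_def)
  have sect_s: "sect (s f) f" if X: "X \<in> Ob CC" "len CC X > 0" and f: "f \<in> Hom CC Y X" for f X Y
  proof -
    have "\<exists>w. sect w f"
      using pullback_square_lift[OF pull[OF X ft_mor_Hom[OF f]] section_square_commutes[OF f] f]
      unfolding sect_iff[OF f] src_q[OF X f] by blast
    then show ?thesis
      unfolding s_def by (rule someI_ex)
  qed
  \<comment> \<open>Two sections of \<open>f\<close> lift the same cone through a pull-back. Hence
    (d) only requires a check that \<open>s f\<close> is a section of
    \<open>f \<cdot> qm CC g U\<close>.\<close>
  have sect_unique: "w = s f"
    if X: "X \<in> Ob CC" "len CC X > 0" and f: "f \<in> Hom CC Y X" and "sect w f" for w f X Y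
    using pullback_square_lift_unique[OF pull[OF X ft_mor_Hom[OF f]]] sect_s[OF X f] \<open>sect w f\<close>
      section_square_commutes[OF f] f src_q[OF X f]
    unfolding sect_iff[OF f] by auto
  have "C_system CC s"
  proof (unfold_locales, goal_cases)
    case (1 X f Y)
    then show ?case using sect_s[OF 1] by (simp add: sect_iff)
  next
    case (2 X f Y)
    then show ?case using sect_s[OF 2] by (simp add: sect_iff)
  next
    case (3 X f Y)
    then show ?case using sect_s[OF 3] by (simp add: sect_iff)
  next
    case (4 X f Y U g)
    note f = 4(3) and U = 4(4,5) and g = 4(6) and X = 4(7)
    note q = qm_Hom[OF U g] and f' = ft_mor_Hom[OF f]
    have fq: "f \<cdot> qm CC g U \<in> Hom CC Y U"
      using comp_Hom[OF _ q] f X by simp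
    have ft_fq: "ft_mor CC (f \<cdot> qm CC g U) = ft_mor CC f \<cdot> g"
      using ft_mor_comp_qm[OF U g] f X by simp
    have sf: "s f \<in> Hom CC Y (pb CC (ft_mor CC f) X)"
      "s f \<cdot> pr CC (pb CC (ft_mor CC f) X) = Idm CC Y" "s f \<cdot> qm CC (ft_mor CC f) X = f"
      using sect_s[OF 4(1-3)] by (simp_all add: sect_iff[OF f])
    have "s f \<cdot> (qm CC (ft_mor CC f) X \<cdot> qm CC g U) = f \<cdot> qm CC g U"
      using comp_assoc[OF sf(1) qm_Hom[OF 4(1,2) f']] q sf(3) X by fastforce
    \<comment> \<open>Since \<open>X = pb CC g U\<close>, \<open>pb_comp\<close> identifies
      \<open>pb CC (ft_mor CC f \<cdot> g) U\<close> with \<open>pb CC (ft_mor CC f) X\<close>, so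
      (a) and (b) carry over unchanged; (c) is the preceding equation.\<close>
    then have "sect (s f) (f \<cdot> qm CC g U)"
      using sf(1,2) pb_comp[OF U f' g] qm_comp[OF U f' g] X
      by (simp add: sect_iff[OF fq] ft_fq)
    then show ?case
      by (rule sect_unique[OF U fq])
  qed
  then show ?thesis
    by blast
qed

end

lemma (in C_system) pullback_canonical_square:
  assumes "X \<in> Ob CC" "len CC X > 0" "f \<in> Hom CC Y (ft CC X)"
  shows "pullback_square CC (qm CC f X) (pr CC (pb CC f X)) (pr CC X) f"
  unfolding pullback_square_def
proof (intro conjI allI impI)
  show "commutative_square CC (qm CC f X) (pr CC (pb CC f X)) (pr CC X) f"
    by (rule canonical_square_commutes[OF assms])
next
  fix u v
  assume sq: "commutative_square CC u v (pr CC X) f"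
  define Z where "Z = src CC u"
  define P where "P = pb CC f X"
  have P: "P \<in> Ob CC" "len CC P > 0" "ft CC P = Y"
    unfolding P_def using pb_Ob len_pb ft_pb assms by blast+
  have q: "qm CC f X \<in> Hom CC P X" and p: "pr CC P \<in> Hom CC P Y"
    unfolding P_def using qm_Hom pr_pb_Hom assms by blast+
  have u: "u \<in> Hom CC Z X" and v: "v \<in> Hom CC Z Y" and uv: "u \<cdot> pr CC X = v \<cdot> f"
    using sq assms(3) pr_Hom[OF assms(1)] by (auto simp: commutative_square_def Z_def Hom_def)
  have v': "v \<in> Hom CC Z (ft CC P)"
    using v P(3) by simp
  \<comment> \<open>Commutativity of the cone is what places \<open>s u\<close> over
    \<open>v\<close>: its target is the pull-back of \<open>X\<close> along
    \<open>v \<cdot> f\<close>, that is, of \<open>P\<close> along \<open>v\<close>.\<close>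
  have ft_u: "ft_mor CC u = v \<cdot> f"
    using ft_mor_eq[OF u] uv by simp
  have pb_u: "pb CC (ft_mor CC u) X = pb CC v P"
    unfolding ft_u P_def by (rule pb_comp[OF assms(1,2) v assms(3)])
  have qm_u: "qm CC (ft_mor CC u) X = qm CC v P \<cdot> qm CC f X"
    unfolding ft_u P_def by (rule qm_comp[OF assms(1,2) v assms(3)])
  note qv = qm_Hom[OF P(1,2) v'] and pv = pr_pb_Hom[OF P(1,2) v']
  have su: "s u \<in> Hom CC Z (pb CC v P)" "s u \<cdot> pr CC (pb CC v P) = Idm CC Z"
    "u = s u \<cdot> (qm CC v P \<cdot> qm CC f X)"
    using s_Hom[OF assms(1,2) u] s_pr[OF assms(1,2) u] s_qm[OF assms(1,2) u] pb_u qm_u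
    by simp_all
  have "\<exists>!w. w \<in> Hom CC Z P \<and> w \<cdot> qm CC f X = u \<and> w \<cdot> pr CC P = v"
  proof (intro ex1I conjI)
    show "s u \<cdot> qm CC v P \<in> Hom CC Z P"
      by (rule comp_Hom[OF su(1) qv])
    show "s u \<cdot> qm CC v P \<cdot> qm CC f X = u"
      using comp_assoc[OF su(1) qv q] su(3) by simp
    \<comment> \<open>The canonical square over \<open>P\<close> with bottom arrow \<open>v\<close>
      turns the left-hand projection into one that \<open>s u\<close> splits.\<close>
    have "s u \<cdot> qm CC v P \<cdot> pr CC P = s u \<cdot> (pr CC (pb CC v P) \<cdot> v)"
      using comp_assoc[OF su(1) qv pr_Hom[OF P(1)]] qm_pr[OF P(1,2) v'] by simp
    also have "\<dots> = v"
      using comp_assoc[OF su(1) pv v] su(2) Id_left[OF v] by simp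
    finally show "s u \<cdot> qm CC v P \<cdot> pr CC P = v" .
  next
    fix w
    assume w: "w \<in> Hom CC Z P \<and> w \<cdot> qm CC f X = u \<and> w \<cdot> pr CC P = v"
    then have ft_w: "ft_mor CC w = v"
      using ft_mor_eq by blast
    \<comment> \<open>Axiom (d) with \<open>P\<close>, \<open>X\<close>, \<open>f\<close> in the
      roles of \<open>X\<close>, \<open>U\<close>, \<open>g\<close>; here \<open>ft CC P = Y\<close>
      makes \<open>f\<close> start at \<open>ft CC P\<close>.\<close>
    have "s w = s (w \<cdot> qm CC f X)"
      using s_pb[OF P(1,2) _ assms(1,2)] w assms(3) P(3) P_def by blast
    moreover have "w = s w \<cdot> qm CC v P"
      using s_qm[OF P(1,2)] w ft_w by fastforce
    ultimately show "w = s u \<cdot> qm CC v P"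
      using w by simp
  qed
  moreover have "src CC (qm CC f X) = P"
    using q by (simp add: Hom_def)
  ultimately show "\<exists>!w. w \<in> Hom CC (src CC u) (src CC (qm CC f X)) \<and>
      w \<cdot> qm CC f X = u \<and> w \<cdot> pr CC (pb CC f X) = v"
    by (simp add: Z_def P_def)
qed

theorem proposition0p2p4:
  fixes CC :: "('o, 'm) c0_data"
  assumes "C0_system CC"
  shows "(\<forall>X\<in>Ob CC. \<forall>Y\<in>Ob CC. \<forall>f\<in>Hom CC Y (ft CC X). len CC X > 0 \<longrightarrow>
            pullback_square CC (qm CC f X) (pr CC (pb CC f X)) (pr CC X) f)
     \<longleftrightarrow> (\<exists>s. C_system CC s)"
proof -
  interpret C0_system CC by (rule assms)
  show ?thesis
    \<comment> \<open>\<open>Hom_src\<close> supplies \<open>Y \<in> Ob CC\<close>, which is needed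
      to instantiate the bounded quantifier over \<open>Y\<close>.\<close>
    using C_system_if_pullback C_system.pullback_canonical_square Hom_src by meson
qed

end
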